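(* Let $t_1,t_2\in[1/2,1]$ and $p\in[1/2,2]$. Then the double inequality $$2^{p-2}\pi(1+r')^{1-2p}\left\{\left[t_{1}+(1-t_{1})r'\right]^2+\left[(1-t_{1})+t_{1}r'\right]^2\right\}^{p}<\mathcal{E}(r)<2^{p-2}\pi(1+r')^{1-2p}\left\{\left[t_{2}+(1-t_{2})r'\right]^2+\left[(1-t_{2})+t_{2}r'\right]^2\right\}^{p}$$ holds for all $r\in(0,1)$ if and only if $t_{1}\leq \frac12+\frac12\sqrt{\frac{1}{4p}}$ and $t_{2}\geq \frac12+\frac12\sqrt{(4/\pi)^{1/p}-1}$.
   Context: For $r\in(0,1)$, $\mathcal{E}(r)=\int_{0}^{\pi/2}(1-r^2\sin^2\theta)^{1/2}\,d\theta$ is the complete elliptic integral of the second kind, and $r'=\sqrt{1-r^2}$. *)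

theory Defs
  imports "HOL-Analysis.Analysis"
begin

definition elliptic_E :: "real \<Rightarrow> real" where
  "elliptic_E r = integral {0..pi / 2} (\<lambda>\<theta>. sqrt (1 - r\<^sup>2 * (sin \<theta>)\<^sup>2))"

definition compl_modulus :: "real \<Rightarrow> real" where
  "compl_modulus r = sqrt (1 - r\<^sup>2)"

end

theory Submission
  imports Defs
begin

text \<open>
  Write \<open>s = r'\<close>, \<open>h = ((1 - s) / (1 + s))\<^sup>2\<close> and \<open>u = (2 t - 1)\<^sup>2\<close>. The bounds become
  \<open>(\<pi>/4) (1 + s) (1 + u h)\<^sup>p\<close>, and the Gauss--Kummer series for the perimeter of an ellipse gives
  \<open>E(r) = (\<pi>/4) (1 + s) G(h)\<close> with \<open>G(h) = \<Sum>\<^sub>n (1/2 choose n)\<^sup>2 h\<^sup>n\<close>: the integrand is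
  \<open>(1 + s)/2\<close> times \<open>|(1 + z) powr (1/2)|\<^sup>2\<close> with \<open>z = sqrt h * cis (2\<theta>)\<close>, and Parseval applies.
  So the question is when \<open>(1 + u h)\<^sup>p\<close> lies below or above \<open>G(h) = 1 + h/4 + h\<^sup>2/64 + \<dots>\<close>
  on \<open>(0,1)\<close>, where \<open>G(1-) = 4/\<pi>\<close>.

  Necessity is read off from \<open>h \<rightarrow> 0\<close> and \<open>h \<rightarrow> 1\<close>. Sufficiency reduces to \<open>p = 2\<close>: there
  \<open>(1 + h/8)\<^sup>2\<close> is exactly the beginning of the series, and \<open>G(h) - (1 + k h)\<^sup>2\<close> with
  \<open>(1 + k)\<^sup>2 = 4/\<pi>\<close> has negative coefficients at \<open>h\<close> and \<open>h\<^sup>2\<close>, positive ones afterwards, and sum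
  \<open>0\<close>. Bernoulli's inequality and convexity of \<open>x powr (2/p)\<close> pass from \<open>2\<close> to \<open>p \<le> 2\<close>.
\<close>

section \<open>Binomial coefficients of 1/2, Parseval and the Gauss-Kummer series\<close>

lemma gchoose_half_rec:
  "((1/2::real) gchoose Suc n) = (1/2 gchoose n) * ((1/2 - of_nat n) / of_nat (Suc n))"
  by (simp add: gbinomial_prod_rev field_simps prod.atLeast0_lessThan_Suc)

text \<open>Consecutive coefficients have a ratio of absolute value at most 1. This crude bound is
  enough to dominate the binomial series by a geometric one.\<close>

lemma abs_gchoose_half_le_1: "\<bar>(1/2::real) gchoose n\<bar> \<le> 1"
proof (induction n)
  case (Suc n)
  have "\<bar>(1/2 - real n) / real (Suc n)\<bar> \<le> 1"
    by (simp add: field_simps abs_if)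
  with Suc have "\<bar>(1/2::real) gchoose n\<bar> * \<bar>(1/2 - real n) / real (Suc n)\<bar> \<le> 1 * 1"
    by (intro mult_mono) auto
  then show ?case by (simp only: gchoose_half_rec abs_mult)
qed simp

lemma has_integral_cos_even:
  fixes k :: int
  assumes "k \<noteq> 0"
  shows "((\<lambda>\<theta>. cos (2 * of_int k * \<theta>)) has_integral 0) {0..pi/2}"
proof -
  have "((\<lambda>\<theta>. cos (2 * of_int k * \<theta>)) has_integral
      (sin (2 * of_int k * (pi/2)) / (2 * of_int k) - sin (2 * of_int k * 0) / (2 * of_int k))) {0..pi/2}"
    using assms
    by (intro fundamental_theorem_of_calculus)
       (auto intro!: derivative_eq_intros simp flip: has_real_derivative_iff_has_vector_derivative)
  then show ?thesis by (simp add: mult.commute sin_integer_2pi sin_int_times_real)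
qed

text \<open>Parseval on \<open>{0..pi/2}\<close>. Since \<open>c\<close> is real, the double sum
  contains only cosines of even multiples of \<theta>, whose integrals vanish off the diagonal;
  sines need not integrate to 0 here.\<close>

lemma has_integral_trig_polynomial_cmod_squared:
  fixes c :: "nat \<Rightarrow> real"
  shows "((\<lambda>\<theta>. (cmod (\<Sum>n<N. of_real (c n) * cis (2 * real n * \<theta>)))\<^sup>2)
           has_integral (pi/2 * (\<Sum>n<N. (c n)\<^sup>2))) {0..pi/2}"
proof -
  have *: "(cmod (\<Sum>n<N. of_real (c n) * cis (2 * real n * \<theta>)))\<^sup>2 =
      (\<Sum>m<N. \<Sum>n<N. c m * c n * cos (2 * of_int (int m - int n) * \<theta>))" for \<theta>
  proof -
    have "(cmod (\<Sum>n<N. of_real (c n) * cis (2 * real n * \<theta>)))\<^sup>2 =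
       (\<Sum>n<N. c n * cos (2 * real n * \<theta>))\<^sup>2 + (\<Sum>n<N. c n * sin (2 * real n * \<theta>))\<^sup>2"
      by (simp add: cmod_power2)
    also have "\<dots> = (\<Sum>m<N. \<Sum>n<N. c m * c n * (cos (2 * real m * \<theta>) * cos (2 * real n * \<theta>)
        + sin (2 * real m * \<theta>) * sin (2 * real n * \<theta>)))"
      by (simp add: power2_eq_square sum_product algebra_simps flip: sum.distrib)
    also have "\<dots> = (\<Sum>m<N. \<Sum>n<N. c m * c n * cos (2 * of_int (int m - int n) * \<theta>))"
      by (simp add: algebra_simps flip: cos_diff)
    finally show ?thesis .
  qed
  have term_int: "((\<lambda>\<theta>. c m * c n * cos (2 * of_int (int m - int n) * \<theta>)) has_integral
      (if m = n then pi/2 * (c n)\<^sup>2 else 0)) {0..pi/2}" for m n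
  proof (cases "m = n")
    case True
    then show ?thesis
      using has_integral_const_real[of "(c n)\<^sup>2" 0 "pi/2"] by (simp add: power2_eq_square)
  next
    case False
    then show ?thesis
      using has_integral_mult_right[OF has_integral_cos_even[of "int m - int n"], of "c m * c n"] by simp
  qed
  have "((\<lambda>\<theta>. \<Sum>m<N. \<Sum>n<N. c m * c n * cos (2 * of_int (int m - int n) * \<theta>)) has_integral
      (\<Sum>m<N. \<Sum>n<N. if m = n then pi/2 * (c n)\<^sup>2 else 0)) {0..pi/2}"
    by (intro has_integral_sum term_int) auto
  then show ?thesis by (simp add: * sum_distrib_left)
qed

text \<open>Parseval is applied to the partial sums of the binomial series of
  \<open>(1 + z) powr (1/2)\<close> at \<open>z = x * cis (2 * \<theta>)\<close>. Dominated
  convergence then passes to the limit, with a constant majorant from the geometric series.\<close>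

lemma gchoose_half_squared_sums:
  fixes x :: real
  assumes "0 \<le> x" "x < 1"
  shows "(\<lambda>n. (1/2 gchoose n)\<^sup>2 * (x\<^sup>2)^n) sums
           (2/pi * integral {0..pi/2} (\<lambda>\<theta>. cmod (1 + of_real x * cis (2 * \<theta>))))"
proof -
  define c where "c n = (1/2 gchoose n) * x^n" for n
  define f where "f N \<theta> = (cmod (\<Sum>n<N. of_real (c n) * cis (2 * real n * \<theta>)))\<^sup>2" for N \<theta>
  have c_le: "\<bar>c n\<bar> \<le> x^n" for n
    using mult_right_mono[OF abs_gchoose_half_le_1[of n], of "x^n"] assms
    by (simp add: c_def abs_mult power_abs)
  have f_int: "(f N has_integral pi/2 * (\<Sum>n<N. (c n)\<^sup>2)) {0..pi/2}" for N
    unfolding f_def by (rule has_integral_trig_polynomial_cmod_squared)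
  have f_lim: "(\<lambda>N. f N \<theta>) \<longlonglongrightarrow> cmod (1 + of_real x * cis (2 * \<theta>))" for \<theta>
  proof -
    let ?z = "of_real x * cis (2 * \<theta>)"
    have "cmod ?z < 1" using assms by (simp add: norm_mult)
    then have "(\<lambda>n. ((1/2::complex) gchoose n) * ?z ^ n) sums (1 + ?z) powr (1/2)"
      by (rule gen_binomial_complex)
    moreover have "((1/2::complex) gchoose n) * ?z ^ n = of_real (c n) * cis (2 * real n * \<theta>)" for n
      by (simp add: c_def power_mult_distrib Complex.DeMoivre mult_ac gbinomial_prod_rev)
    ultimately have "(\<lambda>N. \<Sum>n<N. of_real (c n) * cis (2 * real n * \<theta>)) \<longlonglongrightarrow> (1 + ?z) powr (1/2)"
      by (simp add: sums_def)
    then have "(\<lambda>N. f N \<theta>) \<longlonglongrightarrow> (cmod ((1 + ?z) powr (1/2)))\<^sup>2"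
      unfolding f_def by (intro tendsto_intros)
    \<comment> \<open>The power 1/2 is the principal square root, so squaring its modulus gives back
      the modulus of \<open>1 + ?z\<close>.\<close>
    also have "(cmod ((1 + ?z) powr (1/2)))\<^sup>2 = cmod (1 + ?z)"
      by (metis csqrt_conv_powr norm_power power2_csqrt)
    finally show ?thesis .
  qed
  have f_bound: "norm (f N \<theta>) \<le> (1 / (1 - x))\<^sup>2" for N \<theta>
  proof -
    have "cmod (\<Sum>n<N. of_real (c n) * cis (2 * real n * \<theta>)) \<le> (\<Sum>n<N. x^n)"
      by (intro sum_norm_le) (simp add: norm_mult c_le)
    also have "\<dots> \<le> (\<Sum>n. x^n)"
      using assms by (intro sum_le_suminf) (auto intro: summable_geometric)
    also have "\<dots> = 1 / (1 - x)" using assms by (simp add: suminf_geometric)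
    finally show ?thesis unfolding f_def by (simp add: power_mono)
  qed
  have "(\<lambda>N. integral {0..pi/2} (f N)) \<longlonglongrightarrow>
      integral {0..pi/2} (\<lambda>\<theta>. cmod (1 + of_real x * cis (2 * \<theta>)))"
    by (rule dominated_convergence(2)[where h = "\<lambda>_. (1 / (1 - x))\<^sup>2"])
       (use f_int f_bound f_lim in \<open>auto intro: has_integral_integrable\<close>)
  then have "(\<lambda>N. pi/2 * (\<Sum>n<N. (c n)\<^sup>2)) \<longlonglongrightarrow>
      integral {0..pi/2} (\<lambda>\<theta>. cmod (1 + of_real x * cis (2 * \<theta>)))"
    by (simp add: integral_unique[OF f_int])
  from tendsto_mult_left[OF this, of "2/pi"] show ?thesis
    by (simp add: sums_def c_def power_mult_distrib mult.commute flip: power_mult)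
qed

lemma elliptic_E_series:
  assumes "r \<in> {0<..<1}" and "s = compl_modulus r"
  shows "(\<lambda>n. ((1/2::real) gchoose n)\<^sup>2 * (((1 - s) / (1 + s))\<^sup>2) ^ n) sums
           (4 / pi * elliptic_E r / (1 + s))"
proof -
  define x where "x = (1 - s) / (1 + s)"
  have r2: "r\<^sup>2 < 1" using assms(1) by (simp add: power_less_one_iff)
  have s: "0 < s" "s < 1" "s\<^sup>2 = 1 - r\<^sup>2"
    using assms r2 by (auto simp: compl_modulus_def)
  have x: "0 \<le> x" "x < 1" using s by (auto simp: x_def)
  \<comment> \<open>The choice of \<open>x\<close> gives \<open>(1 + s) * (1 + x) = 2\<close> and
    \<open>(1 + s)\<^sup>2 * x = 1 - s\<^sup>2 = r\<^sup>2\<close>, which matches the constant and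
    the \<open>sin\<close> term of the two squares.\<close>
  have integrand: "sqrt (1 - r\<^sup>2 * (sin \<theta>)\<^sup>2) = (1 + s) / 2 * cmod (1 + of_real x * cis (2 * \<theta>))" for \<theta>
  proof (rule real_sqrt_unique)
    have "(cmod (1 + of_real x * cis (2 * \<theta>)))\<^sup>2 = (1 + x * cos (2*\<theta>))\<^sup>2 + (x * sin (2*\<theta>))\<^sup>2"
      by (simp add: cmod_power2)
    also have "\<dots> = 1 + 2 * x * cos (2*\<theta>) + x\<^sup>2 * ((sin (2*\<theta>))\<^sup>2 + (cos (2*\<theta>))\<^sup>2)"
      by algebra
    also have "\<dots> = (1 + x)\<^sup>2 - 4 * x * (sin \<theta>)\<^sup>2"
      using cos_double_sin[of \<theta>] sin_cos_squared_add[of "2*\<theta>"] by algebra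
    finally have cmod_eq: "(cmod (1 + of_real x * cis (2 * \<theta>)))\<^sup>2 = (1 + x)\<^sup>2 - 4 * x * (sin \<theta>)\<^sup>2" .
    have "((1 + s) / 2 * cmod (1 + of_real x * cis (2 * \<theta>)))\<^sup>2 =
        ((1 + s) / 2 * (1 + x))\<^sup>2 - ((1 + s)\<^sup>2 * x) * (sin \<theta>)\<^sup>2"
      unfolding power_mult_distrib cmod_eq by (simp add: power2_eq_square field_simps)
    also have "(1 + s) / 2 * (1 + x) = 1" using s by (simp add: x_def field_simps)
    also have "(1 + s)\<^sup>2 * x = 1 - s\<^sup>2" using s by (simp add: x_def field_simps power2_eq_square)
    finally show "((1 + s) / 2 * cmod (1 + of_real x * cis (2 * \<theta>)))\<^sup>2 = 1 - r\<^sup>2 * (sin \<theta>)\<^sup>2"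
      using s by simp
  qed (use s in auto)
  have E: "elliptic_E r = (1 + s) / 2 * integral {0..pi/2} (\<lambda>\<theta>. cmod (1 + of_real x * cis (2 * \<theta>)))"
    unfolding elliptic_E_def integrand by (rule integral_mult_right)
  then have "2/pi * integral {0..pi/2} (\<lambda>\<theta>. cmod (1 + of_real x * cis (2 * \<theta>))) = 4 / pi * elliptic_E r / (1 + s)"
    using s unfolding E by simp
  with gchoose_half_squared_sums[OF x] show ?thesis by (simp add: x_def)
qed

section \<open>Estimates for the elliptic integral and the Gauss-Kummer function\<close>

lemma elliptic_E_bounds:
  assumes "r \<in> {0<..<1}"
  shows "1 \<le> elliptic_E r" "elliptic_E r \<le> 1 + compl_modulus r"
proof -
  define s where "s = compl_modulus r"
  have "r\<^sup>2 < 1" using assms by (simp add: power_less_one_iff)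
  then have s: "0 < s" "s\<^sup>2 = 1 - r\<^sup>2"
    using assms by (auto simp: compl_modulus_def s_def)
  \<comment> \<open>The integrand is the Euclidean norm of
    \<open>(cos \<theta>, s * sin \<theta>)\<close>, which lies between the first coordinate and the
    sum of both, as these are nonnegative on \<open>{0..pi/2}\<close>.\<close>
  have eq: "1 - r\<^sup>2 * (sin \<theta>)\<^sup>2 = (cos \<theta>)\<^sup>2 + (s * sin \<theta>)\<^sup>2" for \<theta>
    by (simp add: s power_mult_distrib cos_squared_eq algebra_simps)
  have int: "(\<lambda>\<theta>. sqrt (1 - r\<^sup>2 * (sin \<theta>)\<^sup>2)) integrable_on {0..pi/2}"
    by (intro integrable_continuous_interval continuous_intros)
  have cos_int: "(cos has_integral 1) {0..pi/2}"
    by (rule fundamental_theorem_of_calculus[of 0 "pi/2" sin cos, simplified])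
       (auto intro!: derivative_eq_intros simp flip: has_real_derivative_iff_has_vector_derivative)
  have sin_int: "(sin has_integral 1) {0..pi/2}"
    by (rule fundamental_theorem_of_calculus[of 0 "pi/2" "\<lambda>x. - cos x" sin, simplified])
       (auto intro!: derivative_eq_intros simp flip: has_real_derivative_iff_has_vector_derivative)
  show "1 \<le> elliptic_E r"
    unfolding elliptic_E_def
    using integral_le[OF has_integral_integrable[OF cos_int] int] integral_unique[OF cos_int]
    by (simp add: eq real_le_rsqrt)
  have up_int: "((\<lambda>\<theta>. cos \<theta> + s * sin \<theta>) has_integral (1 + s * 1)) {0..pi/2}"
    by (intro has_integral_add has_integral_mult_right cos_int sin_int)
  have "sqrt (1 - r\<^sup>2 * (sin \<theta>)\<^sup>2) \<le> cos \<theta> + s * sin \<theta>" if "\<theta> \<in> {0..pi/2}" for \<theta>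
  proof -
    have "0 \<le> cos \<theta>" "0 \<le> s * sin \<theta>"
      using that s by (auto intro!: cos_ge_zero mult_nonneg_nonneg sin_ge_zero)
    then show ?thesis unfolding eq by (rule sqrt_sum_squares_le_sum)
  qed
  then show "elliptic_E r \<le> 1 + compl_modulus r"
    unfolding elliptic_E_def
    using integral_le[OF int has_integral_integrable[OF up_int]] integral_unique[OF up_int]
    by (simp add: s_def)
qed

text \<open>This is the hypergeometric function F(-1/2, -1/2; 1; h).\<close>

definition gauss_kummer :: "real \<Rightarrow> real" where
  "gauss_kummer h = (\<Sum>n. (1/2 gchoose n)\<^sup>2 * h ^ n)"

lemma elliptic_E_gauss_kummer:
  assumes "r \<in> {0<..<1}" and "s = compl_modulus r"
  shows "elliptic_E r = pi/4 * (1 + s) * gauss_kummer (((1 - s) / (1 + s))\<^sup>2)"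
proof -
  have "r\<^sup>2 < 1" using assms(1) by (simp add: power_less_one_iff)
  then have "1 + s > 0" using assms by (simp add: compl_modulus_def add_pos_nonneg)
  moreover have "gauss_kummer (((1 - s) / (1 + s))\<^sup>2) = 4 / pi * elliptic_E r / (1 + s)"
    using sums_unique[OF elliptic_E_series[OF assms]] by (simp only: gauss_kummer_def)
  ultimately show ?thesis by simp
qed

lemma gauss_kummer_sums:
  assumes "0 \<le> h" "h < 1"
  shows "(\<lambda>n. (1/2 gchoose n)\<^sup>2 * h ^ n) sums gauss_kummer h"
  using gchoose_half_squared_sums[of "sqrt h"] assms
  by (simp add: gauss_kummer_def sums_iff)

text \<open>The inverse of the substitution \<open>h = ((1 - r') / (1 + r'))\<^sup>2\<close>.\<close>

lemma modulus_parametrization: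
  assumes "0 < h" "h < 1"
  obtains r s where "r \<in> {0<..<1}" "s = compl_modulus r" "0 < s"
    "((1 - s) / (1 + s))\<^sup>2 = h" "1 + s = 2 / (1 + sqrt h)"
proof -
  define x where "x = sqrt h"
  define s where "s = (1 - x) / (1 + x)"
  define r where "r = sqrt (1 - s\<^sup>2)"
  have x: "0 < x" "x < 1" "x\<^sup>2 = h" using assms by (auto simp: x_def)
  then have s: "0 < s" "s < 1" by (auto simp: s_def)
  then have s2: "0 < s\<^sup>2" "s\<^sup>2 < 1" by (auto simp: power_less_one_iff)
  have "(1 - s) / (1 + s) = x" using x by (simp add: s_def field_simps)
  then have h: "((1 - s) / (1 + s))\<^sup>2 = h" using x by simp
  show ?thesis
  proof (rule that[of r s])
    show "r \<in> {0<..<1}" using s2 by (auto simp: r_def)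
    show "s = compl_modulus r" using s s2 by (simp add: r_def compl_modulus_def)
    show "1 + s = 2 / (1 + sqrt h)" using x by (simp add: s_def field_simps flip: x_def)
  qed (use s h in auto)
qed

text \<open>These translate the two bounds on \<open>elliptic_E\<close>. Together they pin down the
  limit \<open>4 / pi\<close> as h tends to 1, without evaluating the series there.\<close>

lemma gauss_kummer_ge: "2 / pi * (1 + sqrt h) \<le> gauss_kummer h"
  and gauss_kummer_le: "gauss_kummer h \<le> 4 / pi" if h: "0 < h" "h < 1"
proof -
  obtain r s where rs: "r \<in> {0<..<1}" "s = compl_modulus r" "0 < s"
    "((1 - s) / (1 + s))\<^sup>2 = h" "1 + s = 2 / (1 + sqrt h)"
    using modulus_parametrization[OF h] by metis
  have E: "elliptic_E r = pi/4 * (1 + s) * gauss_kummer h"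
    using elliptic_E_gauss_kummer[OF rs(1,2)] rs(4) by simp
  have "(1 + s) * 1 \<ge> (1 + s) * (pi/4 * gauss_kummer h)"
    using elliptic_E_bounds(2)[OF rs(1)] E rs(2) by (simp add: mult_ac)
  then have "pi/4 * gauss_kummer h \<le> 1"
    by (rule mult_left_le_imp_le) (use rs(3) in simp)
  then show "gauss_kummer h \<le> 4 / pi" by (simp add: field_simps)
  have "0 < 1 + sqrt h" using h by (simp add: add_pos_nonneg)
  then show "2 / pi * (1 + sqrt h) \<le> gauss_kummer h"
    using elliptic_E_bounds(1)[OF rs(1)] unfolding E rs(5) by (simp add: field_simps)
qed

text \<open>For h in (0,1) the partial sum is at most \<open>gauss_kummer h\<close>, hence at most
  \<open>4 / pi\<close>; being a polynomial in h, it keeps this bound as h tends to 1.\<close>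

lemma sum_gchoose_half_squared_le: "(\<Sum>n<N. ((1/2::real) gchoose n)\<^sup>2) \<le> 4 / pi"
proof (rule tendsto_upperbound)
  show "((\<lambda>h. \<Sum>n<N. ((1/2::real) gchoose n)\<^sup>2 * h ^ n) \<longlongrightarrow> (\<Sum>n<N. (1/2 gchoose n)\<^sup>2)) (at_left 1)"
    by (rule tendsto_eq_intros refl | simp)+
  show "\<forall>\<^sub>F h in at_left 1. (\<Sum>n<N. ((1/2::real) gchoose n)\<^sup>2 * h ^ n) \<le> 4 / pi"
    using eventually_at_left_real[of 0 1, OF zero_less_one]
  proof eventually_elim
    case (elim h)
    then have "(\<Sum>n<N. ((1/2::real) gchoose n)\<^sup>2 * h ^ n) \<le> gauss_kummer h"
      using gauss_kummer_sums[of h] unfolding sums_iff gauss_kummer_def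
      by (intro sum_le_suminf) auto
    with gauss_kummer_le[of h] elim show ?case by simp
  qed
qed simp

lemma gchoose_half_squared_values:
  "((1/2::real) gchoose 2)\<^sup>2 = 1/64" "((1/2::real) gchoose 3)\<^sup>2 = 1/256"
  by (simp_all add: eval_nat_numeral gchoose_half_rec)

text \<open>For the upper bound, \<open>h ^ n \<le> h ^ 3\<close> when \<open>n \<ge> 3\<close>, and
  these coefficients sum to at most \<open>4/pi - 81/64\<close>, because the first three sum to
  \<open>1 + 1/4 + 1/64 = 81/64\<close>.\<close>

lemma gauss_kummer_cubic_bounds:
  assumes h: "0 < h" "h < 1"
  shows "1 + h/4 + h\<^sup>2/64 < gauss_kummer h"
    and "gauss_kummer h \<le> 1 + h/4 + h\<^sup>2/64 + (4/pi - 81/64) * h ^ 3"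
proof -
  let ?c = "\<lambda>n. ((1/2::real) gchoose n)\<^sup>2"
  have sums: "(\<lambda>n. ?c n * h ^ n) sums gauss_kummer h"
    using h by (intro gauss_kummer_sums) auto
  \<comment> \<open>The term \<open>n = 3\<close> is kept to make the lower bound strict.\<close>
  have "(\<Sum>n<4. ?c n * h ^ n) \<le> gauss_kummer h"
    using sums h unfolding sums_iff gauss_kummer_def by (intro sum_le_suminf) auto
  moreover have "(\<Sum>n<4. f n) = f 0 + f 1 + f 2 + f 3" for f :: "nat \<Rightarrow> real"
    by (simp add: eval_nat_numeral)
  ultimately have "1 + h/4 + h\<^sup>2/64 + h ^ 3/256 \<le> gauss_kummer h"
    by (simp add: gchoose_half_squared_values power_divide)
  moreover have "0 < h ^ 3/256" using h by simp
  ultimately show "1 + h/4 + h\<^sup>2/64 < gauss_kummer h" by linarith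
  have "(\<Sum>n<N. ?c n * h ^ n) \<le> 1 + h/4 + h\<^sup>2/64 + (4/pi - 81/64) * h ^ 3" if "N \<ge> 3" for N
  proof -
    have split: "(\<Sum>n<N. f n) = f 0 + f 1 + f 2 + (\<Sum>n=3..<N. f n)" for f :: "nat \<Rightarrow> real"
      using sum.atLeastLessThan_concat[of 0 3 N f] that
      by (simp add: eval_nat_numeral atLeast0LessThan)
    have "(\<Sum>n=3..<N. ?c n * h ^ n) \<le> (\<Sum>n=3..<N. ?c n * h ^ 3)"
      using h by (intro sum_mono mult_left_mono power_decreasing) auto
    also have "\<dots> = (\<Sum>n=3..<N. ?c n) * h ^ 3" by (simp add: sum_distrib_right)
    also have "\<dots> \<le> (4/pi - 81/64) * h ^ 3"
      using sum_gchoose_half_squared_le[of N] h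
      by (intro mult_right_mono) (auto simp: split gchoose_half_squared_values power_divide)
    finally show ?thesis
      by (simp add: split gchoose_half_squared_values power_divide)
  qed
  with sums show "gauss_kummer h \<le> 1 + h/4 + h\<^sup>2/64 + (4/pi - 81/64) * h ^ 3"
    unfolding sums_def by (intro LIMSEQ_le_const2) auto
qed

text \<open>The base is the chord from 1 at \<open>h = 0\<close> to \<open>2 / sqrt pi\<close> at
  \<open>h = 1\<close>, written as a convex combination for later use. Its square minus
  \<open>1 + h/4 + h\<^sup>2/64\<close> has positive coefficients at h and \<open>h\<^sup>2\<close>
  with sum \<open>4/pi - 81/64\<close>; lowering both powers to \<open>h ^ 3\<close> reaches the
  cubic upper bound.\<close>

lemma gauss_kummer_less_square:
  assumes h: "0 < h" "h < 1"
  shows "gauss_kummer h < ((1 - h) + h * (2 / sqrt pi))\<^sup>2"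
proof -
  define k where "k = 2 / sqrt pi - 1"
  have k: "(1 + k)\<^sup>2 = 4/pi" by (simp add: k_def power_divide)
  \<comment> \<open>The two cubic bounds at the same h force this, so no numerical estimate of pi
    enters.\<close>
  have "81/64 < 4/pi"
  proof -
    have "0 < (4/pi - 81/64) * h ^ 3" using gauss_kummer_cubic_bounds[OF h] by linarith
    then show ?thesis using h by (simp add: zero_less_mult_iff)
  qed
  then have "(9/8)\<^sup>2 < (1 + k)\<^sup>2" unfolding k by (simp add: power2_eq_square)
  moreover have "0 \<le> 1 + k" by (simp add: k_def)
  ultimately have "9/8 < 1 + k" by (rule power2_less_imp_less)
  then have k8: "1/8 < k" by simp
  then have "(1/8)\<^sup>2 < k\<^sup>2" by (intro power_strict_mono) auto
  then have "1/64 < k\<^sup>2" by (simp add: power2_eq_square)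
  moreover have "h ^ 3 < h" "h ^ 3 \<le> h\<^sup>2"
    using h power_strict_decreasing[of 1 3 h] power_decreasing[of 2 3 h] by auto
  ultimately have "(2 * k - 1/4) * h ^ 3 + (k\<^sup>2 - 1/64) * h ^ 3 <
      (2 * k - 1/4) * h + (k\<^sup>2 - 1/64) * h\<^sup>2"
    using k8 by (intro add_less_le_mono mult_strict_left_mono mult_left_mono) auto
  moreover have "(2 * k - 1/4) * h ^ 3 + (k\<^sup>2 - 1/64) * h ^ 3 = (4/pi - 81/64) * h ^ 3"
    by (simp add: power2_eq_square algebra_simps flip: k)
  ultimately have "1 + h/4 + h\<^sup>2/64 + (4/pi - 81/64) * h ^ 3 < (1 + k * h)\<^sup>2"
    by (simp add: power2_eq_square algebra_simps)
  also have "1 + k * h = (1 - h) + h * (2 / sqrt pi)" by (simp add: k_def algebra_simps)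
  finally show ?thesis using gauss_kummer_cubic_bounds(2)[OF h] by simp
qed

section \<open>Sharp comparison of powers with the Gauss-Kummer function\<close>

lemma powr_Bernoulli:
  fixes x q :: real
  assumes "0 \<le> x" "1 \<le> q"
  shows "1 + q * x \<le> (1 + x) powr q"
proof -
  \<comment> \<open>A convex function lies above its tangent at 1.\<close>
  have "(1 + x) powr q - 1 powr q \<ge> q * 1 powr (q - 1) * ((1 + x) - 1)"
    using assms
    by (intro convex_on_imp_above_tangent[OF powr_convex[OF assms(2)]])
       (auto intro!: derivative_eq_intros simp: interior_open)
  then show ?thesis by simp
qed

lemma powr_less_gauss_kummer_iff:
  fixes p u :: real
  assumes p: "0 < p" "p \<le> 2" and u: "0 \<le> u"
  shows "(\<forall>h\<in>{0<..<1}. (1 + u * h) powr p < gauss_kummer h) \<longleftrightarrow> u \<le> 1 / (4 * p)"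
proof
  assume *: "\<forall>h\<in>{0<..<1}. (1 + u * h) powr p < gauss_kummer h"
  show "u \<le> 1 / (4 * p)"
  proof (rule ccontr)
    assume "\<not> u \<le> 1 / (4 * p)"
    then have pos: "0 < p * u - 1/4" using p by (simp add: field_simps)
    \<comment> \<open>The subtracted quadratic majorizes \<open>gauss_kummer\<close> on (0,1) and
      has slope 1/4 at 0, so a positive derivative of \<open>f\<close> at 0 contradicts the
      assumption for small h.\<close>
    define f where "f h = (1 + u * h) powr p - (1 + h/4 + 2 * h\<^sup>2)" for h
    have "(f has_real_derivative (p * u - 1/4)) (at 0)"
      unfolding f_def by (auto intro!: derivative_eq_intros)
    from DERIV_pos_inc_right[OF this pos] obtain d
      where d: "0 < d" "\<And>h. 0 < h \<Longrightarrow> h < d \<Longrightarrow> f 0 < f h" by auto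
    define h where "h = min (1/2) (d/2)"
    have h: "0 < h" "h < 1" "h < d" using d(1) by (auto simp: h_def)
    have "4/pi \<le> 2" using pi_gt3 by (simp add: field_simps)
    then have "(4/pi - 81/64) * h ^ 3 \<le> 1 * h\<^sup>2"
      using h power_decreasing[of 2 3 h] by (intro mult_mono) auto
    moreover have "h\<^sup>2/64 \<le> h\<^sup>2" by simp
    ultimately have "gauss_kummer h \<le> 1 + h/4 + 2 * h\<^sup>2"
      using gauss_kummer_cubic_bounds(2)[OF h(1,2)] by linarith
    moreover have "(1 + u * h) powr p < gauss_kummer h" using * h by simp
    moreover have "0 < f h" using d(2)[OF h(1,3)] by (simp add: f_def)
    ultimately show False by (simp add: f_def)
  qed
next
  assume u': "u \<le> 1 / (4 * p)"
  show "\<forall>h\<in>{0<..<1}. (1 + u * h) powr p < gauss_kummer h"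
  proof
    fix h :: real assume "h \<in> {0<..<1}"
    then have h: "0 < h" "h < 1" by auto
    have "1 + u * h \<le> 1 + 1 / (4 * p) * h" using u' h by (intro add_left_mono mult_right_mono) auto
    \<comment> \<open>Bernoulli applies with exponent \<open>2/p \<ge> 1\<close>; the base
      \<open>1 + h/8\<close> is the one whose square begins the series.\<close>
    also have "\<dots> = 1 + 2/p * (h/8)" by simp
    also have "\<dots> \<le> (1 + h/8) powr (2/p)" using h p by (intro powr_Bernoulli) auto
    finally have "(1 + u * h) powr p \<le> ((1 + h/8) powr (2/p)) powr p"
      using p u h by (intro powr_mono2) auto
    also have "\<dots> = (1 + h/8)\<^sup>2" using p h by (simp add: powr_powr)
    also have "\<dots> = 1 + h/4 + h\<^sup>2/64" by (simp add: power2_eq_square field_simps)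
    also have "\<dots> < gauss_kummer h" by (rule gauss_kummer_cubic_bounds(1)[OF h])
    finally show "(1 + u * h) powr p < gauss_kummer h" .
  qed
qed

lemma gauss_kummer_less_powr_iff:
  fixes p u :: real
  assumes p: "0 < p" "p \<le> 2" and u: "0 \<le> u"
  shows "(\<forall>h\<in>{0<..<1}. gauss_kummer h < (1 + u * h) powr p) \<longleftrightarrow> (4/pi) powr (1/p) - 1 \<le> u"
proof
  assume *: "\<forall>h\<in>{0<..<1}. gauss_kummer h < (1 + u * h) powr p"
  \<comment> \<open>Letting h tend to 1 turns the lower bound on \<open>gauss_kummer\<close> into
    \<open>4/pi \<le> (1 + u) powr p\<close>.\<close>
  have "2/pi * (1 + sqrt 1) \<le> (1 + u) powr p"
  proof (rule tendsto_upperbound)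
    show "((\<lambda>h. 2/pi * (1 + sqrt h)) \<longlongrightarrow> 2/pi * (1 + sqrt 1)) (at_left 1)"
      by (intro tendsto_intros)
    show "\<forall>\<^sub>F h in at_left 1. 2/pi * (1 + sqrt h) \<le> (1 + u) powr p"
      using eventually_at_left_real[of 0 1, OF zero_less_one]
    proof eventually_elim
      case (elim h)
      then have "2/pi * (1 + sqrt h) \<le> gauss_kummer h" by (intro gauss_kummer_ge) auto
      also have "\<dots> \<le> (1 + u * h) powr p" using * elim by (simp add: less_imp_le)
      also have "\<dots> \<le> (1 + u) powr p"
        using elim p u by (intro powr_mono2) (auto simp: mult_left_le)
      finally show ?case .
    qed
  qed simp
  then have "(4/pi) powr (1/p) \<le> ((1 + u) powr p) powr (1/p)"
    using p by (intro powr_mono2) auto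
  then show "(4/pi) powr (1/p) - 1 \<le> u" using p u by (simp add: powr_powr)
next
  assume u': "(4/pi) powr (1/p) - 1 \<le> u"
  show "\<forall>h\<in>{0<..<1}. gauss_kummer h < (1 + u * h) powr p"
  proof
    fix h :: real assume "h \<in> {0<..<1}"
    then have h: "0 < h" "h < 1" by auto
    have w: "0 < (1 - h) + h * (2 / sqrt pi)" using h by (intro add_pos_pos) auto
    have sq: "(2 / sqrt pi) powr (2/p) = (4/pi) powr (1/p)"
    proof -
      have "(2 / sqrt pi) powr (2/p) = ((2 / sqrt pi) powr 2) powr (1/p)" unfolding powr_powr by simp
      also have "(2 / sqrt pi) powr 2 = 4/pi" by (simp add: power_divide)
      finally show ?thesis .
    qed
    \<comment> \<open>Convexity of the power \<open>2/p \<ge> 1\<close> bounds it by the chord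
      between its values 1 and \<open>(4/pi) powr (1/p)\<close> at the ends.\<close>
    have "((1 - h) * 1 + h * (2 / sqrt pi)) powr (2/p) \<le>
        (1 - h) * 1 powr (2/p) + h * (2 / sqrt pi) powr (2/p)"
      using convex_onD[OF powr_convex[of "2/p"], of h 1 "2 / sqrt pi"] p h by simp
    also have "\<dots> = 1 + ((4/pi) powr (1/p) - 1) * h" by (simp add: sq algebra_simps)
    also have "\<dots> \<le> 1 + u * h" using u' h by simp
    finally have "(((1 - h) + h * (2 / sqrt pi)) powr (2/p)) powr p \<le> (1 + u * h) powr p"
      using p by (intro powr_mono2) auto
    moreover have "(((1 - h) + h * (2 / sqrt pi)) powr (2/p)) powr p = ((1 - h) + h * (2 / sqrt pi))\<^sup>2"
      using p w by (simp add: powr_powr)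
    ultimately show "gauss_kummer h < (1 + u * h) powr p"
      using gauss_kummer_less_square[OF h] by simp
  qed
qed

section \<open>Return to the modulus r and the parameters of the means\<close>

lemma mean_bound_eq:
  fixes s t p :: real
  assumes s: "0 < s"
  shows "2 powr (p - 2) * pi * (1 + s) powr (1 - 2 * p)
      * ((t + (1 - t) * s)\<^sup>2 + ((1 - t) + t * s)\<^sup>2) powr p
    = pi/4 * (1 + s) * (1 + (2 * t - 1)\<^sup>2 * ((1 - s) / (1 + s))\<^sup>2) powr p"
proof -
  define y where "y = (1 - s) / (1 + s)"
  define w where "w = 1 + (2 * t - 1)\<^sup>2 * y\<^sup>2"
  have "w > 0" unfolding w_def by (intro add_pos_nonneg) auto
  have y: "y * (1 + s) = 1 - s" using s by (simp add: y_def)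
  \<comment> \<open>Use \<open>a\<^sup>2 + b\<^sup>2 = ((a + b)\<^sup>2 + (a - b)\<^sup>2) /
    2\<close>: here the sum is \<open>1 + s\<close> and the difference is
    \<open>(2 * t - 1) * (1 - s)\<close>.\<close>
  have "(t + (1 - t) * s)\<^sup>2 + ((1 - t) + t * s)\<^sup>2 = ((1 + s)\<^sup>2 + (2 * t - 1)\<^sup>2 * (y * (1 + s))\<^sup>2) / 2"
    unfolding y by (simp add: power2_eq_square field_simps)
  also have "\<dots> = (1 + s)\<^sup>2 / 2 * w" unfolding w_def by algebra
  also have "\<dots> powr p = ((1 + s) powr 2) powr p / 2 powr p * w powr p"
    using s \<open>w > 0\<close> by (simp add: powr_mult powr_divide)
  also have "2 powr (p - 2) * pi * (1 + s) powr (1 - 2 * p) * \<dots> = pi/4 * (1 + s) * w powr p"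
    using s unfolding powr_powr powr_diff by simp
  finally show ?thesis by (simp add: w_def y_def)
qed

text \<open>All three quantities share the positive factor \<open>pi/4 * (1 + s)\<close>, which
  cancels, and h runs through all of (0,1) as r does.\<close>

lemma elliptic_E_double_inequality_iff:
  fixes t1 t2 p :: real
  shows "(\<forall>r\<in>{0<..<1::real}.
            2 powr (p - 2) * pi * (1 + compl_modulus r) powr (1 - 2 * p)
              * ((t1 + (1 - t1) * compl_modulus r)\<^sup>2 + ((1 - t1) + t1 * compl_modulus r)\<^sup>2) powr p
              < elliptic_E r
          \<and> elliptic_E r
              < 2 powr (p - 2) * pi * (1 + compl_modulus r) powr (1 - 2 * p)
                * ((t2 + (1 - t2) * compl_modulus r)\<^sup>2 + ((1 - t2) + t2 * compl_modulus r)\<^sup>2) powr p)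
      \<longleftrightarrow> (\<forall>h\<in>{0<..<1}. (1 + (2 * t1 - 1)\<^sup>2 * h) powr p < gauss_kummer h
              \<and> gauss_kummer h < (1 + (2 * t2 - 1)\<^sup>2 * h) powr p)"
    (is "(\<forall>r\<in>_. ?P r) \<longleftrightarrow> (\<forall>h\<in>_. ?Q h)")
proof -
  have PQ: "?P r \<longleftrightarrow> ?Q (((1 - s) / (1 + s))\<^sup>2)"
    if rs: "r \<in> {0<..<1}" "s = compl_modulus r" "0 < s" for r s
    using rs(3) unfolding rs(2)[symmetric] mean_bound_eq[OF rs(3)] elliptic_E_gauss_kummer[OF rs(1,2)]
    by (simp add: mult_less_cancel_left_pos)
  show ?thesis
  proof
    assume P: "\<forall>r\<in>{0<..<1}. ?P r"
    show "\<forall>h\<in>{0<..<1}. ?Q h"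
    proof
      fix h :: real assume "h \<in> {0<..<1}"
      then obtain r s where rs: "r \<in> {0<..<1}" "s = compl_modulus r" "0 < s" "((1 - s) / (1 + s))\<^sup>2 = h"
        using modulus_parametrization[of h] by (metis greaterThanLessThan_iff)
      show "?Q h" using P PQ[OF rs(1-3)] rs(1) unfolding rs(4) by blast
    qed
  next
    assume Q: "\<forall>h\<in>{0<..<1}. ?Q h"
    show "\<forall>r\<in>{0<..<1}. ?P r"
    proof
      fix r :: real assume r: "r \<in> {0<..<1}"
      define s where "s = compl_modulus r"
      have "0 < r\<^sup>2" "r\<^sup>2 < 1" using r by (auto simp: power_less_one_iff)
      then have s: "0 < s" "s < 1" by (auto simp: s_def compl_modulus_def)
      then have "((1 - s) / (1 + s))\<^sup>2 \<in> {0<..<1}" by (auto simp: power_less_one_iff)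
      with Q show "?P r" using PQ[OF r s_def s(1)] by blast
    qed
  qed
qed

theorem theorem1p2:
  fixes t1 t2 p :: real
  assumes "t1 \<in> {1/2..1}" and "t2 \<in> {1/2..1}" and "p \<in> {1/2..2}"
  shows "(\<forall>r\<in>{0<..<1::real}.
            2 powr (p - 2) * pi * (1 + compl_modulus r) powr (1 - 2 * p)
              * ((t1 + (1 - t1) * compl_modulus r)\<^sup>2 + ((1 - t1) + t1 * compl_modulus r)\<^sup>2) powr p
              < elliptic_E r
          \<and> elliptic_E r
              < 2 powr (p - 2) * pi * (1 + compl_modulus r) powr (1 - 2 * p)
                * ((t2 + (1 - t2) * compl_modulus r)\<^sup>2 + ((1 - t2) + t2 * compl_modulus r)\<^sup>2) powr p)
         \<longleftrightarrow> t1 \<le> 1/2 + 1/2 * sqrt (1 / (4 * p))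
           \<and> t2 \<ge> 1/2 + 1/2 * sqrt ((4 / pi) powr (1 / p) - 1)"
proof -
  have p: "0 < p" "p \<le> 2" using assms by auto
  \<comment> \<open>As \<open>t1 \<ge> 1/2\<close>, the root of the square is
    \<open>2 * t1 - 1\<close>. In HOL \<open>sqrt\<close> is increasing on the whole real line, so
    \<open>a\<close> may have any sign.\<close>
  have "(2 * t1 - 1)\<^sup>2 \<le> a \<longleftrightarrow> t1 \<le> 1/2 + 1/2 * sqrt a" for a
    using real_sqrt_le_iff[of "(2 * t1 - 1)\<^sup>2" a] assms(1) by (auto simp del: real_sqrt_le_iff)
  moreover have "a \<le> (2 * t2 - 1)\<^sup>2 \<longleftrightarrow> t2 \<ge> 1/2 + 1/2 * sqrt a" for a
    using real_sqrt_le_iff[of a "(2 * t2 - 1)\<^sup>2"] assms(2) by (auto simp del: real_sqrt_le_iff)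
  ultimately show ?thesis
    unfolding elliptic_E_double_inequality_iff
    by (simp only: ball_conj_distrib powr_less_gauss_kummer_iff[OF p zero_le_power2]
        gauss_kummer_less_powr_iff[OF p zero_le_power2])
qed

end
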